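(* Let $n \geq 2$, let $A$ be the design matrix of a $p_1$ model on $n$ nodes (in any of the three versions: no reciprocal effect, constant reciprocation, edge-dependent reciprocation), let $P_A = \{Ap : p \in D_n\}$ be its marginal polytope, let $C_A = \mathrm{cone}(A)$ be its marginal cone, and let $\mu : S_A \to P_A$, $p \mapsto Ap$, be the moment map. Let $t \in P_A$. Then $t \in \mathrm{ri}(P_A)$ if and only if $t \in \mathrm{ri}(C_A)$. Furthermore, for every (nonempty) face $G$ of $P_A$ there exists one facial set $\mathcal{F}$ of $C_A$ such that, for each $t \in \mathrm{ri}(G)$, $\mathcal{F} = \mathrm{supp}(p)$, where $p = \mu^{-1}(t)$.
   Context: Notation. $\Delta_3 \subset \mathbb{R}^4$ is the standard simplex (probability vectors of length 4). For each pair $1 \leq i < j \leq n$ (a dyad), a vector $p_{i,j} = (p_{i,j}(0,0), p_{i,j}(1,0), p_{i,j}(0,1), p_{i,j}(1,1)) \in \mathbb{R}^4$ is considered, and these are concatenated (pairs ordered lexicographically) into $p = (p_{1,2}, p_{1,3}, \ldots, p_{n-1,n}) \in \mathbb{R}^{2n(n-1)}$. Set $D_n = \{ (p_{1,2}, \ldots, p_{n-1,n}) : p_{i,j} \in \Delta_3 \text{ for all } i<j\}$. The $p_1$ model. The Holland-Leinhardt equations are, for all $i<j$, $$\log p_{i,j}(0,0) = \lambda_{i,j},$$ $$\log p_{i,j}(1,0) = \lambda_{i,j} + \alpha_i + \beta_j + \theta,$$ $$\log p_{i,j}(0,1) = \lambda_{i,j} + \alpha_j + \beta_i + \theta,$$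 $$\log p_{i,j}(1,1) = \lambda_{i,j} + \alpha_i + \beta_j + \alpha_j + \beta_i + 2\theta + \rho_{i,j},$$ with real parameters. Three versions are considered: (1) $\rho_{i,j} = 0$ (no reciprocal effect); (2) $\rho_{i,j} = \rho$ (constant reciprocation); (3) $\rho_{i,j} = \rho + \rho_i + \rho_j$ (edge-dependent reciprocation). The free parameters are $\lambda_{i,j}$ ($i<j$), $\theta$, $\alpha_1,\ldots,\alpha_n$, $\beta_1,\ldots,\beta_n$, together with $\rho$ in version (2), and $\rho,\rho_1,\ldots,\rho_n$ in version (3). Design matrix. $A$ is the matrix whose $2n(n-1)$ columns are indexed by the coordinates $p_{i,j}(a,b)$, $i<j$, $a,b\in\{0,1\}$ (pairs $(i,j)$ ordered lexicographically and, within each pair, $(a,b)$ in the order $(0,0),(1,0),(0,1),(1,1)$), whose rows are indexed by the parameters (the $\binom{n}{2}$ parameters $\lambda_{i,j}$ first), and whose entry in a given row and column is the coefficient of that row's parameter in the expression for the logarithm of that column's probability. Thus the equations read $\log p = A^\top \zeta$ with $\zeta$ the parameter vector. Let $a_k$ denote the $k$-th column of $A$. $M_A$ is the set of strictly positive $p \in D_n$ with $\log p = A^\top\zeta$ for some real vector $\zeta$. $S_A$ is the closure of $M_A$; equivalently $S_A = V_A \cap D_n$, where $V_A$ is the set of nonnegative real points of the toric variety of the toric ideal $I_A$ of $A$. The map $\mu : S_A \to P_A$, $\mu(p) = Ap$, is known to be a homeomorphism, so $\mu^{-1}(t)$ is the unique $p \in S_A$ with $Ap = t$. $C_A = \mathrm{cone}(A)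 = \{Ax : x \in \mathbb{R}^{2n(n-1)}, x \geq 0\}$ is the convex cone generated by the columns of $A$. A set $\mathcal{F} \subseteq \{1,\ldots,2n(n-1)\}$ is a facial set of $C_A$ if there exists a vector $c$ such that $c^\top a_i = 0$ for all $i \in \mathcal{F}$ and $c^\top a_i < 0$ for all $i \notin \mathcal{F}$. $\mathrm{ri}$ denotes relative interior, and $\mathrm{supp}(x) = \{i : x_i \neq 0\}$. *)

theory Defs
  imports "HOL-Analysis.Analysis" "HOL-Library.Cardinality"
begin

text \<open>
  The nodes are the elements of a finite linearly ordered type \<open>'n\<close> with at least two elements
  (class \<^class>\<open>card2\<close>), so that \<open>n = CARD('n)\<close>.
\<close>

typedef (overloaded) 'n dyad = "{(i :: 'n :: {card2, linorder}, j). i < j}"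
  morphisms endpoints Dyad
proof -
  have "\<not> is_singleton (UNIV :: 'n set)"
    using two_le_card[where 'a = 'n] by (auto simp: is_singleton_altdef)
  then obtain x y :: 'n where "x \<noteq> y"
    unfolding is_singleton_def by (metis UNIV_I empty_iff insertI1 is_singletonI' is_singleton_def)
  then have "x < y \<or> y < x" by auto
  then show ?thesis by blast
qed

instance dyad :: ("{card2, linorder}") finite
proof
  have "inj (endpoints :: 'a dyad \<Rightarrow> _)"
    by (metis endpoints_inject injI)
  then show "finite (UNIV :: 'a dyad set)"
    by (rule finite_imageD[rotated]) simp
qed

definition lo :: "'n::{card2, linorder} dyad \<Rightarrow> 'n" where
  "lo d = fst (endpoints d)"

definition hi :: "'n::{card2, linorder} dyad \<Rightarrow> 'n" where
  "hi d = snd (endpoints d)"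

lemma lo_less_hi: "lo d < hi d"
  using endpoints[of d] by (auto simp: lo_def hi_def)

text \<open>
  The coordinate \<open>p\<^sub>i\<^sub>,\<^sub>j(a,b)\<close> of \<open>p\<close> is \<open>p $ (d, a, b)\<close>, where \<open>i = lo d\<close>, \<open>j = hi d\<close> and
  \<^const>\<open>True\<close>, \<^const>\<open>False\<close> stand for 1, 0.
\<close>

type_synonym 'n coord = "'n dyad \<times> bool \<times> bool"

lemma card_coord:
  "CARD('n::{card2, linorder} coord) = 2 * CARD('n) * (CARD('n) - 1)"
proof -
  let ?L = "{(i :: 'n, j). i < j}" and ?G = "{(i :: 'n, j). j < i}"
  have "range (endpoints :: 'n dyad \<Rightarrow> _) = ?L"
    using type_definition.Rep_range[OF type_definition_dyad] .
  then have L: "card ?L = CARD('n dyad)"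
    by (metis card_image endpoints_inject injI)
  have "prod.swap ` ?L = ?G" by force
  then have G: "card ?G = card ?L"
    by (metis card_image inj_swap)
  have "(UNIV :: ('n \<times> 'n) set) = (?L \<union> ?G) \<union> (\<lambda>i. (i, i)) ` UNIV"
    by force
  then have "CARD('n \<times> 'n) = card ((?L \<union> ?G) \<union> (\<lambda>i. (i, i)) ` UNIV)"
    by (rule arg_cong)
  also have "\<dots> = card (?L \<union> ?G) + card ((\<lambda>i :: 'n. (i, i)) ` UNIV)"
    by (rule card_Un_disjoint) auto
  also have "card (?L \<union> ?G) = card ?L + card ?G"
    by (rule card_Un_disjoint) auto
  also have "card ((\<lambda>i :: 'n. (i, i)) ` UNIV) = CARD('n)"
    by (rule card_image) (auto intro: injI)
  finally have "CARD('n) * CARD('n) = 2 * CARD('n dyad) + CARD('n)"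
    by (simp add: L G card_prod)
  then have "2 * CARD('n dyad) = CARD('n) * (CARD('n) - 1)"
    by (simp add: diff_mult_distrib2)
  then show ?thesis
    by (simp add: card_prod)
qed

definition prob_vectors :: "(real ^ 'n::{card2, linorder} coord) set" where
  "prob_vectors = {p. \<forall>d. (\<forall>a b. 0 \<le> p $ (d, a, b)) \<and>
     p $ (d, False, False) + p $ (d, True, False) + p $ (d, False, True) + p $ (d, True, True) = 1}"

datatype p1_version = No_Reciprocity | Constant_Reciprocity | Edge_Dependent_Reciprocity

datatype ('d, 'n) param = Par_lambda 'd | Par_theta | Par_alpha 'n | Par_beta 'n | Par_rho | Par_rho_node 'n

type_synonym 'n p1_param = "('n dyad, 'n) param"

fun p1_params :: "p1_version \<Rightarrow> 'n::{card2, linorder} p1_param set" where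
  "p1_params No_Reciprocity = - ({Par_rho} \<union> range Par_rho_node)"
| "p1_params Constant_Reciprocity = - range Par_rho_node"
| "p1_params Edge_Dependent_Reciprocity = UNIV"

fun reciprocity ::
  "p1_version \<Rightarrow> ('n::{card2, linorder} p1_param \<Rightarrow> real) \<Rightarrow> 'n dyad \<Rightarrow> real" where
  "reciprocity No_Reciprocity \<zeta> d = 0"
| "reciprocity Constant_Reciprocity \<zeta> d = \<zeta> Par_rho"
| "reciprocity Edge_Dependent_Reciprocity \<zeta> d =
     \<zeta> Par_rho + \<zeta> (Par_rho_node (lo d)) + \<zeta> (Par_rho_node (hi d))"

fun p1_log_prob ::
  "p1_version \<Rightarrow> ('n::{card2, linorder} p1_param \<Rightarrow> real) \<Rightarrow> 'n coord \<Rightarrow> real" where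
  "p1_log_prob v \<zeta> (d, False, False) = \<zeta> (Par_lambda d)"
| "p1_log_prob v \<zeta> (d, True, False) =
     \<zeta> (Par_lambda d) + \<zeta> (Par_alpha (lo d)) + \<zeta> (Par_beta (hi d)) + \<zeta> Par_theta"
| "p1_log_prob v \<zeta> (d, False, True) =
     \<zeta> (Par_lambda d) + \<zeta> (Par_alpha (hi d)) + \<zeta> (Par_beta (lo d)) + \<zeta> Par_theta"
| "p1_log_prob v \<zeta> (d, True, True) =
     \<zeta> (Par_lambda d) + \<zeta> (Par_alpha (lo d)) + \<zeta> (Par_beta (hi d)) + \<zeta> (Par_alpha (hi d)) + \<zeta> (Par_beta (lo d))
       + 2 * \<zeta> Par_theta + reciprocity v \<zeta> d"

text \<open>
  The three versions have different numbers of parameters, so the rows of the design matrix are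
  indexed by an arbitrary finite type \<open>'r\<close> together with a bijection \<open>param_of\<close> from \<open>'r\<close>
  onto \<open>p1_params v\<close>.  The log-probabilities are linear forms in the parameters; the coefficient of a
  parameter is the value of the form at the corresponding unit vector.
\<close>

definition design_matrix ::
  "p1_version \<Rightarrow> ('r::finite \<Rightarrow> 'n::{card2, linorder} p1_param) \<Rightarrow> real ^ 'n coord ^ 'r" where
  "design_matrix v param_of = (\<chi> r k. p1_log_prob v (\<lambda>q. if q = param_of r then 1 else 0) k)"

lemma transpose_design_matrix:
  fixes param_of :: "'r::finite \<Rightarrow> 'n::{card2, linorder} p1_param"
  assumes "bij_betw param_of UNIV (p1_params v)"
  shows "(transpose (design_matrix v param_of) *v (\<chi> r. \<zeta> (param_of r))) $ k = p1_log_prob v \<zeta> k"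
proof -
  obtain d a b where k: "k = (d, a, b)"
    by (cases k)
  let ?u = "\<lambda>q r. if q = param_of r then 1 else (0 :: real)"
  have unit: "(\<Sum>r\<in>UNIV. ?u q r * \<zeta> (param_of r)) = \<zeta> q" if q: "q \<in> p1_params v" for q
  proof -
    obtain s where s: "q = param_of s"
      using assms q unfolding bij_betw_def by blast
    have "?u q r = (if r = s then 1 else 0)" for r
      using assms unfolding s bij_betw_def by (auto dest: injD)
    then show ?thesis
      by (simp add: s if_distrib[of "\<lambda>x. x * _"] cong: if_cong)
  qed
  have lhs: "(transpose (design_matrix v param_of) *v (\<chi> r. \<zeta> (param_of r))) $ k =
      (\<Sum>r\<in>UNIV. p1_log_prob v (\<lambda>q. ?u q r) k * \<zeta> (param_of r))"
    by (simp add: matrix_vector_mult_def transpose_def design_matrix_def)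
  have mem: "Par_lambda d \<in> p1_params v" "Par_theta \<in> p1_params v"
    "Par_alpha i \<in> p1_params v" "Par_beta i \<in> p1_params v" for i
    by (cases v; auto)+
  have rec: "(\<Sum>r\<in>UNIV. reciprocity v (\<lambda>q. ?u q r) d * \<zeta> (param_of r)) = reciprocity v \<zeta> d"
    by (cases v) (simp_all add: distrib_right sum.distrib unit image_iff)
  show ?thesis
    unfolding lhs unfolding k
    by (cases a; cases b)
      (simp_all add: distrib_right sum.distrib mult.assoc unit mem rec
        flip: sum_distrib_left)
qed

definition marginal_polytope :: "real ^ 'n::{card2, linorder} coord ^ 'r::finite \<Rightarrow> (real ^ 'r) set" where
  "marginal_polytope A = (\<lambda>p. A *v p) ` prob_vectors"

definition marginal_cone :: "real ^ 'c::finite ^ 'r::finite \<Rightarrow> (real ^ 'r) set" where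
  "marginal_cone A = {A *v x |x. \<forall>k. 0 \<le> x $ k}"

definition model :: "real ^ 'n::{card2, linorder} coord ^ 'r::finite \<Rightarrow> (real ^ 'n coord) set" where
  "model A = {p \<in> prob_vectors. (\<forall>k. 0 < p $ k) \<and>
     (\<exists>\<zeta>. \<forall>k. ln (p $ k) = (transpose A *v \<zeta>) $ k)}"

definition closed_model :: "real ^ 'n::{card2, linorder} coord ^ 'r::finite \<Rightarrow> (real ^ 'n coord) set" where
  "closed_model A = closure (model A)"

definition moment_map :: "real ^ 'c::finite ^ 'r::finite \<Rightarrow> real ^ 'c \<Rightarrow> real ^ 'r" where
  "moment_map A p = A *v p"

definition facial_set :: "real ^ 'c::finite ^ 'r::finite \<Rightarrow> 'c set \<Rightarrow> bool" where
  "facial_set A F \<longleftrightarrow>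
     (\<exists>c. (\<forall>k\<in>F. c \<bullet> column k A = 0) \<and> (\<forall>k. k \<notin> F \<longrightarrow> c \<bullet> column k A < 0))"

definition supp :: "real ^ 'c::finite \<Rightarrow> 'c set" where
  "supp x = {k. x $ k \<noteq> 0}"

end

theory Submission imports Defs
begin

text \<open>
  The \<open>\<lambda>\<close>-rows of \<open>A\<close> record the dyad sums, so \<open>P\<^sub>A\<close> is the slice of \<open>C\<^sub>A\<close> on which all dyad sums
  are 1; since linear maps commute with relative interiors, both relative interiors consist of the
  images of strictly positive vectors.  A face \<open>G\<close> of \<open>P\<^sub>A\<close> is exposed by some \<open>c\<close>, and subtracting
  from \<open>c\<close> its maximum over each dyad, again by means of the \<open>\<lambda>\<close>-rows, gives a functional that is
  nonpositive on the columns of \<open>A\<close>; its zero set \<open>F\<close> is facial, and \<open>ri G\<close> is the image of the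
  probability vectors with support exactly \<open>F\<close>.

  Every such image point is \<open>Ap\<close> for a \<open>p \<in> S\<^sub>A\<close> with support \<open>F\<close>: \<open>p\<close> has the form
  \<open>exp (A\<^sup>T\<zeta>)\<close> on \<open>F\<close>, where \<open>\<zeta>\<close> minimises a coercive convex function, and it is the limit of the
  normalised model points with parameters \<open>\<zeta> + s c\<close>, \<open>s \<rightarrow> \<infinity>\<close>.  It is unique because points of \<open>S\<^sub>A\<close>
  satisfy the binomial equation of every \<open>u\<close> with \<open>Au = 0\<close>, which fails for \<open>u = p - q \<noteq> 0\<close> by
  monotonicity of powers.
\<close>

section \<open>Coordinates, probability vectors and the functionals given by the
  \<open>\<lambda>\<close>-rows\<close>

lemma sum_coord: "(\<Sum>k\<in>UNIV. f k) = (\<Sum>d\<in>UNIV. \<Sum>ab\<in>UNIV. f (d, ab))"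
  for f :: "'a::finite \<times> 'b::finite \<Rightarrow> 'c::comm_monoid_add"
  unfolding UNIV_Times_UNIV[symmetric] by (simp add: sum.cartesian_product)

lemma prob_vectors_iff:
  "p \<in> prob_vectors \<longleftrightarrow> (\<forall>k. 0 \<le> p $ k) \<and> (\<forall>d. (\<Sum>ab\<in>UNIV. p $ (d, ab)) = 1)"
proof -
  have "(\<Sum>ab\<in>UNIV. p $ (d, ab)) =
      p $ (d, False, False) + p $ (d, True, False) + p $ (d, False, True) + p $ (d, True, True)" for d
    by (subst sum_coord) (simp add: UNIV_bool)
  then show ?thesis
    by (auto simp: prob_vectors_def)
qed

declare split_paired_All [simp del] split_paired_Ex [simp del]

lemma inner_matrix_vector: "c \<bullet> (A *v p) = (\<Sum>k\<in>UNIV. (c \<bullet> column k A) * p $ k)"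
  for A :: "real ^ 'c::finite ^ 'r::finite"
  by (simp add: matrix_mult_sum inner_sum_right scalar_mult_eq_scaleR mult.commute)

lemma transpose_mult_nth: "(transpose A *v z) $ k = z \<bullet> column k A"
  for A :: "real ^ 'c::finite ^ 'r::finite"
  by (simp add: matrix_vector_mult_def transpose_def column_def inner_vec_def mult.commute)

lemma mem_model_iff:
  "p \<in> model A \<longleftrightarrow> p \<in> prob_vectors \<and> (\<exists>z. \<forall>k. p $ k = exp (z \<bullet> column k A))"
proof -
  have "(\<forall>k. 0 < p $ k) \<and> (\<exists>z. \<forall>k. ln (p $ k) = z \<bullet> column k A) \<longleftrightarrow>
      (\<exists>z. \<forall>k. p $ k = exp (z \<bullet> column k A))"
    by (metis exp_gt_zero exp_ln ln_exp)
  then show ?thesis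
    unfolding model_def transpose_mult_nth mem_Collect_eq by blast
qed

lemma supp_nonneg: "(\<And>k. 0 \<le> p $ k) \<Longrightarrow> supp p = {k. 0 < p $ k}"
  by (auto simp: supp_def less_le)

text \<open>Setting the \<open>\<lambda>\<close>-parameters to \<open>m\<close> and all others to 0
  makes every log-probability depend on its dyad only. This is the one property of the design matrix
  that later arguments use, so the three versions need no separate treatment.\<close>

lemma design_matrix_dyad_functional:
  fixes param_of :: "'r::finite \<Rightarrow> 'n::{card2, linorder} p1_param"
  assumes "bij_betw param_of UNIV (p1_params v)"
  shows "\<exists>e. \<forall>k. e \<bullet> column k (design_matrix v param_of) = m (fst k)"
proof -
  define z :: "'n p1_param \<Rightarrow> real" where "z q = (case q of Par_lambda d \<Rightarrow> m d | _ \<Rightarrow> 0)" for q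
  have "p1_log_prob v z (d, a, b) = m d" for d a b
    by (cases a; cases b; cases v) (auto simp: z_def)
  then have "p1_log_prob v z k = m (fst k)" for k
    by (cases k) auto
  then show ?thesis
    using transpose_design_matrix[OF assms, of z] by (metis transpose_mult_nth)
qed

text \<open>Serves twice: it gives closedness, and its linear image is a polytope, whose faces are
  all exposed.\<close>

lemma polytope_prob_vectors: "polytope (prob_vectors :: (real ^ 'n::{card2, linorder} coord) set)"
proof -
  let ?D = "prob_vectors :: (real ^ 'n coord) set"
  have "?D = (\<Inter>k\<in>UNIV. {p. axis k 1 \<bullet> p \<ge> 0}) \<inter>
      (\<Inter>d\<in>UNIV. {p. (\<Sum>ab\<in>UNIV. axis (d, ab) 1) \<bullet> p = 1})"
    by (simp add: set_eq_iff prob_vectors_iff inner_sum_left inner_axis')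
  moreover have "polyhedron \<dots>"
    by (auto intro!: polyhedron_Int polyhedron_Inter polyhedron_halfspace_ge polyhedron_hyperplane)
  ultimately have "polyhedron ?D"
    by simp
  moreover have "?D \<subseteq> cbox 0 1"
  proof
    fix p :: "real ^ 'n coord" assume p: "p \<in> ?D"
    have "p $ (d, ab) \<le> (\<Sum>ab\<in>UNIV. p $ (d, ab))" for d ab
      by (rule member_le_sum) (use p in \<open>auto simp: prob_vectors_iff\<close>)
    then have "p $ (d, ab) \<le> 1" for d ab
      using p by (simp add: prob_vectors_iff)
    then show "p \<in> cbox 0 1"
      using p by (auto simp: mem_box_cart prob_vectors_iff)
  qed
  ultimately show ?thesis
    using bounded_cbox bounded_subset polytope_eq_bounded_polyhedron by blast
qed

section \<open>Relative interiors under a support restriction\<close>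

lemma rel_interior_nonneg_on:
  "rel_interior {x :: real ^ 'c::finite. \<forall>k\<in>F. 0 \<le> x $ k} = {x. \<forall>k\<in>F. 0 < x $ k}"
proof -
  have "open {x :: real ^ 'c. \<forall>k\<in>F. 0 < x $ k}"
  proof -
    have "{x :: real ^ 'c. \<forall>k\<in>F. 0 < x $ k} = (\<Inter>k\<in>F. {x. x $ k > 0})"
      by auto
    then show ?thesis
      by (auto intro!: open_INT open_Collect_less continuous_intros)
  qed
  then have "{x :: real ^ 'c. \<forall>k\<in>F. 0 < x $ k} \<subseteq> interior {x. \<forall>k\<in>F. 0 \<le> x $ k}"
    by (intro interior_maximal) (auto simp: less_imp_le)
  moreover have "interior {x :: real ^ 'c. \<forall>k\<in>F. 0 \<le> x $ k} \<subseteq> {x. 0 < x $ k}" if "k \<in> F" for k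
    using interior_mono[of "{x :: real ^ 'c. \<forall>k\<in>F. 0 \<le> x $ k}" "{x. x $ k \<ge> 0}"] that by auto
  ultimately have eq: "interior {x :: real ^ 'c. \<forall>k\<in>F. 0 \<le> x $ k} = {x. \<forall>k\<in>F. 0 < x $ k}"
    by blast
  \<comment> \<open>Coordinates outside \<open>F\<close> are free, so the set has nonempty interior,
    and this is its relative interior.\<close>
  have "(1 :: real ^ 'c) \<in> {x. \<forall>k\<in>F. 0 < x $ k}"
    by simp
  then show ?thesis
    unfolding eq[symmetric] by (intro rel_interior_nonempty_interior) blast
qed

lemma convex_nonneg_on: "convex {x :: real ^ 'c::finite. \<forall>k\<in>F. 0 \<le> x $ k}"
  by (auto simp: convex_def)

lemma prob_vector_with_supp:
  assumes "\<And>d. \<exists>ab. (d, ab) \<in> F"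
  shows "\<exists>p \<in> prob_vectors. supp p = F"
proof -
  \<comment> \<open>The uniform distribution on the part of \<open>F\<close> in each dyad.\<close>
  define p :: "real ^ 'a coord" where
    "p = (\<chi> k. if k \<in> F then 1 / card {ab. (fst k, ab) \<in> F} else 0)"
  have pos: "card {ab. (d, ab) \<in> F} > 0" for d
    using assms[of d] by (auto simp: card_gt_0_iff)
  have "(\<Sum>ab\<in>UNIV. p $ (d, ab)) = (\<Sum>ab\<in>{ab. (d, ab) \<in> F}. 1 / card {ab. (d, ab) \<in> F})" for d
    unfolding p_def by (rule sum.mono_neutral_cong_right) auto
  then have "p \<in> prob_vectors"
    using pos assms by (auto simp: prob_vectors_iff p_def)
  moreover have "supp p = F"
    using pos by (auto simp: supp_def p_def)
  ultimately show ?thesis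
    by blast
qed

text \<open>The set is a full-dimensional cone cut by the affine set \<open>T\<close>. Relative
  interior commutes with such a cut once \<open>T\<close> meets the relative interior of the cone;
  the hypothesis on \<open>F\<close> ensures this.\<close>

lemma rel_interior_prob_vectors_supported:
  assumes "\<And>d. \<exists>ab. (d, ab) \<in> F"
  shows "rel_interior {p \<in> prob_vectors. supp p \<subseteq> F} = {p \<in> prob_vectors. supp p = F}"
    and "convex {p \<in> prob_vectors. supp p \<subseteq> F}"
proof -
  let ?S = "{p :: real ^ 'a coord. \<forall>k\<in>F. 0 \<le> p $ k}"
  define T :: "(real ^ 'a coord) set" where
    "T = {p. (\<forall>k. k \<notin> F \<longrightarrow> p $ k = 0) \<and> (\<forall>d. (\<Sum>ab\<in>UNIV. p $ (d, ab)) = 1)}"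
  have T: "affine T"
    unfolding affine_def T_def
    by (auto simp: sum.distrib simp flip: sum_distrib_left)
  have D: "{p \<in> prob_vectors. supp p \<subseteq> F} = ?S \<inter> T"
    by (auto simp: T_def prob_vectors_iff supp_def)
  have ri: "{p \<in> prob_vectors. supp p = F} = rel_interior ?S \<inter> T"
  proof (intro set_eqI iffI)
    fix p assume "p \<in> {p \<in> prob_vectors. supp p = F}"
    then show "p \<in> rel_interior ?S \<inter> T"
      by (auto simp: rel_interior_nonneg_on T_def prob_vectors_iff supp_def less_le)
  next
    fix p assume p: "p \<in> rel_interior ?S \<inter> T"
    then have "0 \<le> p $ k" for k
      by (cases "k \<in> F") (auto simp: rel_interior_nonneg_on T_def less_imp_le)
    with p show "p \<in> {p \<in> prob_vectors. supp p = F}"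
      by (auto simp: rel_interior_nonneg_on T_def prob_vectors_iff supp_def)
  qed
  have "rel_interior ?S \<inter> T \<noteq> {}"
    using prob_vector_with_supp[of F] assms unfolding ri[symmetric] by blast
  then show "rel_interior {p \<in> prob_vectors. supp p \<subseteq> F} = {p \<in> prob_vectors. supp p = F}"
    unfolding D ri using convex_affine_rel_interior_Int[OF convex_nonneg_on T] by blast
  show "convex {p \<in> prob_vectors. supp p \<subseteq> F}"
    unfolding D using T by (intro convex_Int convex_nonneg_on affine_imp_convex)
qed

section \<open>Injectivity of the moment map on the closed model\<close>

lemma closed_model_subset: "closed_model A \<subseteq> prob_vectors"
  unfolding closed_model_def
  by (rule closure_minimal)
    (auto simp: model_def intro: polytope_imp_closed polytope_prob_vectors)

text \<open>On the model the logarithms of the two sides differ by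
  \<open>z \<bullet> (A *v u) = 0\<close>. All exponents are positive, so both sides are continuous
  up to zero coordinates and the equation passes to the closure.\<close>

lemma closed_model_binomial:
  assumes p: "p \<in> closed_model A" and u: "A *v u = 0"
  shows "(\<Prod>k | 0 < u $ k. p $ k powr u $ k) = (\<Prod>k | u $ k < 0. p $ k powr (- u $ k))"
proof -
  have model: "(\<Prod>k | 0 < u $ k. q $ k powr u $ k) = (\<Prod>k | u $ k < 0. q $ k powr (- u $ k))"
    if q: "q \<in> model A" for q
  proof -
    obtain z where z: "\<And>k. q $ k = exp (z \<bullet> column k A)"
      using q unfolding mem_model_iff by blast
    let ?f = "\<lambda>k. (z \<bullet> column k A) * u $ k"
    have "0 = z \<bullet> (A *v u)"
      using u by simp
    also have "\<dots> = (\<Sum>k\<in>{k. 0 < u $ k} \<union> {k. u $ k < 0}. ?f k)"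
      unfolding inner_matrix_vector by (rule sum.mono_neutral_right) auto
    also have "\<dots> = (\<Sum>k | 0 < u $ k. ?f k) + (\<Sum>k | u $ k < 0. ?f k)"
      by (rule sum.union_disjoint) auto
    finally have "(\<Sum>k | 0 < u $ k. ?f k) = (\<Sum>k | u $ k < 0. - ?f k)"
      by (simp add: sum_negf)
    then have "exp (\<Sum>k | 0 < u $ k. ?f k) = exp (\<Sum>k | u $ k < 0. - ?f k)"
      by simp
    then show ?thesis
      by (simp add: exp_sum z powr_def mult.commute)
  qed
  obtain q where q: "\<And>i. q i \<in> model A" "q \<longlonglongrightarrow> p"
    using p unfolding closed_model_def closure_sequential by blast
  have nonneg: "0 \<le> q i $ k" for i k
    using q(1)[of i] by (auto simp: model_def prob_vectors_iff)
  have lim: "(\<lambda>i. q i $ k powr a) \<longlonglongrightarrow> p $ k powr a" if "a > 0" for k a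
    by (rule tendsto_powr') (use that nonneg q(2) in \<open>auto intro: tendsto_vec_nth\<close>)
  have "(\<lambda>i. \<Prod>k | 0 < u $ k. q i $ k powr u $ k) \<longlonglongrightarrow> (\<Prod>k | 0 < u $ k. p $ k powr u $ k)"
    by (intro tendsto_prod lim) simp
  moreover have "(\<lambda>i. \<Prod>k | 0 < u $ k. q i $ k powr u $ k) \<longlonglongrightarrow> (\<Prod>k | u $ k < 0. p $ k powr (- u $ k))"
    unfolding model[OF q(1)] by (intro tendsto_prod lim) simp
  ultimately show ?thesis
    by (rule LIMSEQ_unique)
qed

lemma inj_on_moment_map: "inj_on (moment_map A) (closed_model A)"
proof (rule inj_onI)
  have le: "\<not> p $ k > q $ k"
    if p: "p \<in> closed_model A" and q: "q \<in> closed_model A" and eq: "moment_map A p = moment_map A q"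
    for p q k
  proof
    assume k: "p $ k > q $ k"
    define u where "u = p - q"
    have "A *v u = 0"
      using eq by (simp add: u_def moment_map_def matrix_vector_mult_diff_distrib)
    note bin = closed_model_binomial[OF _ this]
    have nn: "0 \<le> p $ i" "0 \<le> q $ i" for i
      using subsetD[OF closed_model_subset p] subsetD[OF closed_model_subset q]
      by (simp_all add: prob_vectors_iff)
    \<comment> \<open>Passing from \<open>q\<close> to \<open>p\<close> strictly raises this product
      and does not raise the one over \<open>u $ i < 0\<close>, yet the binomial equation holds at
      both points.\<close>
    have "(\<Prod>i | 0 < u $ i. q $ i powr u $ i) < (\<Prod>i | 0 < u $ i. p $ i powr u $ i)"
    proof (rule prod_mono_strict)
      show "k \<in> {i. 0 < u $ i}" "q $ k powr u $ k < p $ k powr u $ k"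
        using k nn(2)[of k] by (auto simp: u_def intro!: powr_less_mono2)
      show "0 < p $ i powr u $ i" if "i \<in> {i. 0 < u $ i}" for i
        using that nn(2)[of i] by (auto simp: u_def)
    qed (auto simp: u_def nn intro!: powr_mono2)
    moreover have "(\<Prod>i | u $ i < 0. p $ i powr (- u $ i)) \<le> (\<Prod>i | u $ i < 0. q $ i powr (- u $ i))"
      by (rule prod_mono) (auto simp: u_def nn intro!: powr_mono2)
    ultimately show False
      using bin[OF p] bin[OF q] by simp
  qed
  fix p q
  assume "p \<in> closed_model A" "q \<in> closed_model A" "moment_map A p = moment_map A q"
  then show "p = q"
    using le[of p q] le[of q p] by (simp add: vec_eq_iff) (metis linorder_neqE)
qed

section \<open>Points of the closed model with prescribed image and support\<close>

lemma exp_minus_linear_coercive: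
  fixes q :: real
  assumes "0 < q"
  shows "\<exists>C. \<forall>y. min q 1 * \<bar>y\<bar> - C \<le> exp y - q * y"
proof (intro exI allI)
  fix y :: real
  let ?C = "\<bar>q + 1 - (q + 1) * ln (q + 1)\<bar>"
  show "min q 1 * \<bar>y\<bar> - ?C \<le> exp y - q * y"
  proof (cases "y \<ge> 0")
    case True
    \<comment> \<open>The tangent to \<open>exp\<close> at \<open>ln (q + 1)\<close> has slope
      \<open>q + 1\<close>, so slope 1 remains after subtracting \<open>q * y\<close>.\<close>
    have "1 + (y - ln (q + 1)) \<le> exp (y - ln (q + 1))"
      by (rule exp_ge_add_one_self)
    also have "\<dots> = exp y / (q + 1)"
      using assms by (simp add: exp_diff)
    finally have "(q + 1) * (1 + (y - ln (q + 1))) \<le> exp y"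
      using assms by (simp add: field_simps)
    then have "y + (q + 1 - (q + 1) * ln (q + 1)) \<le> exp y - q * y"
      by (simp add: algebra_simps)
    moreover have "min q 1 * y \<le> 1 * y"
      by (rule mult_right_mono) (use True in auto)
    ultimately show ?thesis
      using True by simp
  next
    case False
    have "min q 1 * (- y) \<le> q * (- y)"
      by (rule mult_right_mono) (use False in auto)
    then have "min q 1 * \<bar>y\<bar> \<le> - (q * y)"
      using False by simp
    then show ?thesis
      using exp_gt_zero[of y] by (smt (verit))
  qed
qed

lemma exponential_moment_solution:
  fixes a :: "'c::finite \<Rightarrow> 'a::euclidean_space" and q :: "'c \<Rightarrow> real"
  assumes q: "\<And>k. k \<in> F \<Longrightarrow> 0 < q k"
  shows "\<exists>z. (\<Sum>k\<in>F. exp (z \<bullet> a k) *\<^sub>R a k) = (\<Sum>k\<in>F. q k *\<^sub>R a k)"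
proof -
  define L :: "'a \<Rightarrow> real ^ 'c" where "L z = (\<chi> k. if k \<in> F then z \<bullet> a k else 0)" for z
  \<comment> \<open>A critical point of \<open>g \<circ> L\<close> solves the equation; minimising over \<open>range L\<close> rather than over \<open>z\<close>
    makes sublevel sets bounded even if the \<open>a k\<close> do not span.\<close>
  define g :: "real ^ 'c \<Rightarrow> real" where "g y = (\<Sum>k\<in>F. exp (y $ k) - q k * y $ k)" for y
  have lin: "linear L"
    by (rule linearI) (auto simp: L_def vec_eq_iff inner_add_left)
  have closed: "closed (range L)"
    using linear_subspace_image[OF lin subspace_UNIV] by (rule closed_subspace)
  obtain C where C: "\<And>k y. k \<in> F \<Longrightarrow> min (q k) 1 * \<bar>y\<bar> - C k \<le> exp y - q k * y"
    using exp_minus_linear_coercive[OF q] by metis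
  define K where "K = range L \<inter> {y. g y \<le> g 0}"
  have "y $ k \<in> {- ((g 0 + (\<Sum>k\<in>F. \<bar>C k\<bar>)) / min (q k) 1) .. (g 0 + (\<Sum>k\<in>F. \<bar>C k\<bar>)) / min (q k) 1}"
    if y: "y \<in> K" and k: "k \<in> F" for y k
  proof -
    \<comment> \<open>With \<open>\<bar>C i\<bar>\<close> added all summands are nonnegative, so a
      bound on the sum bounds each of them.\<close>
    have nn: "0 \<le> exp (y $ i) - q i * y $ i + \<bar>C i\<bar>" if "i \<in> F" for i
    proof -
      have "0 \<le> min (q i) 1 * \<bar>y $ i\<bar>"
        using q[OF that] by simp
      with C[OF that, of "y $ i"] show ?thesis
        by linarith
    qed
    have "min (q k) 1 * \<bar>y $ k\<bar> \<le> exp (y $ k) - q k * y $ k + \<bar>C k\<bar>"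
      using C[OF k, of "y $ k"] by linarith
    also have "\<dots> \<le> (\<Sum>i\<in>F. exp (y $ i) - q i * y $ i + \<bar>C i\<bar>)"
      by (rule member_le_sum) (use k nn in auto)
    also have "\<dots> = g y + (\<Sum>k\<in>F. \<bar>C k\<bar>)"
      by (simp add: g_def sum.distrib)
    also have "\<dots> \<le> g 0 + (\<Sum>k\<in>F. \<bar>C k\<bar>)"
      using y by (simp add: K_def)
    finally have "\<bar>y $ k\<bar> \<le> (g 0 + (\<Sum>k\<in>F. \<bar>C k\<bar>)) / min (q k) 1"
      using q[OF k] by (simp add: field_simps)
    then show ?thesis
      by auto
  qed
  moreover have "y $ k = 0" if "y \<in> K" "k \<notin> F" for y k
    using that by (auto simp: K_def L_def)
  ultimately have "K \<subseteq> cbox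
      (\<chi> k. if k \<in> F then - ((g 0 + (\<Sum>k\<in>F. \<bar>C k\<bar>)) / min (q k) 1) else 0)
      (\<chi> k. if k \<in> F then (g 0 + (\<Sum>k\<in>F. \<bar>C k\<bar>)) / min (q k) 1 else 0)"
    by (force simp: mem_box_cart)
  then have bounded: "bounded K"
    using bounded_cbox bounded_subset by blast
  have cont: "continuous_on UNIV g"
    unfolding g_def by (intro continuous_intros)
  have "closed K"
    unfolding K_def using closed cont by (intro closed_Int closed_Collect_le continuous_intros)
  with bounded have "compact K"
    by (simp add: compact_eq_bounded_closed)
  moreover have "0 \<in> K"
    using linear_0[OF lin] by (auto simp: K_def intro: range_eqI[of _ _ 0])
  ultimately obtain y where y: "y \<in> K" "\<And>x. x \<in> K \<Longrightarrow> g y \<le> g x"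
    using continuous_attains_inf[of K g] cont continuous_on_subset by blast
  \<comment> \<open>Outside \<open>K\<close> the value exceeds \<open>g 0\<close>, hence also
    \<open>g y\<close>, so the minimum over \<open>K\<close> is one over all of
    \<open>range L\<close>.\<close>
  have min: "g y \<le> g (L w)" for w
    using y(2)[of "L w"] y(2)[OF \<open>0 \<in> K\<close>] by (cases "g (L w) \<le> g 0") (auto simp: K_def)
  obtain z where z: "y = L z"
    using y by (auto simp: K_def)
  have "w \<bullet> (\<Sum>k\<in>F. exp (z \<bullet> a k) *\<^sub>R a k) = w \<bullet> (\<Sum>k\<in>F. q k *\<^sub>R a k)" for w
  proof -
    \<comment> \<open>The objective along the line through \<open>z\<close> in direction
      \<open>w\<close>; its derivative at the minimum \<open>s = 0\<close> is the difference of the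
      two inner products.\<close>
    define h where "h s = (\<Sum>k\<in>F. exp ((z + s *\<^sub>R w) \<bullet> a k) - q k * ((z + s *\<^sub>R w) \<bullet> a k))" for s :: real
    have h: "h s = g (L (z + s *\<^sub>R w))" for s
      by (simp add: h_def g_def L_def)
    have "(h has_real_derivative
        (\<Sum>k\<in>F. exp (z \<bullet> a k) * (w \<bullet> a k) - q k * (w \<bullet> a k))) (at 0)"
      unfolding h_def inner_add_left inner_scaleR_left
      by (auto intro!: derivative_eq_intros simp: algebra_simps)
    moreover have "h 0 \<le> h s" for s
      using min by (simp add: h flip: z)
    ultimately have "(\<Sum>k\<in>F. exp (z \<bullet> a k) * (w \<bullet> a k) - q k * (w \<bullet> a k)) = 0"
      by (intro DERIV_local_min[where d = 1]) auto
    then show ?thesis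
      by (simp add: inner_sum_right sum_subtractf)
  qed
  then show ?thesis
    using vector_eq_ldot by blast
qed

lemma limit_in_closed_model:
  fixes A :: "real ^ 'n::{card2, linorder} coord ^ 'r::finite"
  assumes dyad: "\<And>m. \<exists>e. \<forall>k. e \<bullet> column k A = m (fst k)"
    and c: "\<And>k. k \<in> F \<Longrightarrow> c \<bullet> column k A = 0" "\<And>k. k \<notin> F \<Longrightarrow> c \<bullet> column k A < 0"
    and p: "p = (\<chi> k. if k \<in> F then exp (z \<bullet> column k A) else 0)" "p \<in> prob_vectors"
  shows "p \<in> closed_model A"
proof -
  define r where "r i k = exp ((z + real i *\<^sub>R c) \<bullet> column k A)" for i k
  define N where "N i d = (\<Sum>ab\<in>UNIV. r i (d, ab))" for i d
  define q :: "nat \<Rightarrow> real ^ 'n coord" where "q i = (\<chi> k. r i k / N i (fst k))" for i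
  have N: "0 < N i d" for i d
    unfolding N_def by (rule sum_pos) (auto simp: r_def)
  have "q i \<in> model A" for i
  proof -
    \<comment> \<open>Normalising each dyad amounts to shifting the parameter vector by
      \<open>- e\<close>, so \<open>q i\<close> has model form.\<close>
    obtain e where e: "\<And>k. e \<bullet> column k A = ln (N i (fst k))"
      using dyad[of "\<lambda>d. ln (N i d)"] by blast
    have "q i $ k = exp ((z + real i *\<^sub>R c - e) \<bullet> column k A)" for k
      using N by (simp add: q_def r_def inner_diff_left e exp_diff)
    moreover have "q i \<in> prob_vectors"
    proof -
      have "(\<Sum>ab\<in>UNIV. q i $ (d, ab)) = N i d / N i d" for d
        by (simp only: q_def vec_lambda_beta fst_conv flip: sum_divide_distrib N_def)
      then show ?thesis
        using N less_imp_neq[OF N] by (auto simp: prob_vectors_iff q_def r_def less_imp_le)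
    qed
    ultimately show ?thesis
      by (auto simp: mem_model_iff)
  qed
  moreover have "q \<longlonglongrightarrow> p"
  proof -
    have r: "(\<lambda>i. r i k) \<longlonglongrightarrow> p $ k" for k
    proof (cases "k \<in> F")
      case True
      then show ?thesis
        by (simp add: r_def p c inner_add_left)
    next
      case False
      have "exp (c \<bullet> column k A) < 1"
        using c(2)[OF False] by simp
      then have "(\<lambda>i. exp (z \<bullet> column k A) * exp (c \<bullet> column k A) ^ i) \<longlonglongrightarrow> exp (z \<bullet> column k A) * 0"
        by (intro tendsto_mult tendsto_const LIMSEQ_power_zero) simp
      then show ?thesis
        using False by (simp add: r_def p inner_add_left exp_add exp_of_nat_mult)
    qed
    \<comment> \<open>The normalisation disappears in the limit because \<open>p\<close> already has
      dyad sums 1.\<close>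
    have "(\<lambda>i. N i d) \<longlonglongrightarrow> 1" for d
    proof -
      have "(\<lambda>i. N i d) \<longlonglongrightarrow> (\<Sum>ab\<in>UNIV. p $ (d, ab))"
        unfolding N_def by (intro tendsto_sum r)
      then show ?thesis
        using p(2) by (simp add: prob_vectors_iff)
    qed
    then have "(\<lambda>i. r i k / N i (fst k)) \<longlonglongrightarrow> p $ k / 1" for k
      by (intro tendsto_divide r) auto
    then show ?thesis
      by (auto intro!: vec_tendstoI simp: q_def)
  qed
  ultimately show ?thesis
    unfolding closed_model_def closure_sequential by blast
qed

text \<open>The indicator of a dyad is among the functionals in \<open>dyad\<close>. Hence a
  nonnegative vector with the same image as a probability vector is itself one.\<close>

lemma dyad_sum_eq:
  fixes A :: "real ^ 'n::{card2, linorder} coord ^ 'r::finite"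
  assumes dyad: "\<And>m. \<exists>e. \<forall>k. e \<bullet> column k A = m (fst k)"
    and eq: "A *v p = A *v q"
  shows "(\<Sum>ab\<in>UNIV. p $ (d, ab)) = (\<Sum>ab\<in>UNIV. q $ (d, ab))"
proof -
  obtain e where e: "\<And>k. e \<bullet> column k A = (if fst k = d then 1 else 0)"
    using dyad[of "\<lambda>d'. if d' = d then 1 else 0"] by blast
  have "e \<bullet> (A *v x) = (\<Sum>ab\<in>UNIV. x $ (d, ab))" for x
  proof -
    have "e \<bullet> (A *v x) = (\<Sum>d'\<in>UNIV. if d' = d then \<Sum>ab\<in>UNIV. x $ (d', ab) else 0)"
      unfolding inner_matrix_vector by (subst sum_coord, rule sum.cong) (auto simp: e)
    then show ?thesis
      by simp
  qed
  then show ?thesis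
    using eq by metis
qed

lemma closed_model_fibre:
  fixes A :: "real ^ 'n::{card2, linorder} coord ^ 'r::finite"
  assumes dyad: "\<And>m. \<exists>e. \<forall>k. e \<bullet> column k A = m (fst k)"
    and F: "facial_set A F" and q: "q \<in> prob_vectors" "supp q = F"
  shows "\<exists>p \<in> closed_model A. moment_map A p = A *v q \<and> supp p = F"
proof -
  have pos: "0 < q $ k" if "k \<in> F" for k
    using q that supp_nonneg[of q] by (auto simp: prob_vectors_iff)
  obtain z where z: "(\<Sum>k\<in>F. exp (z \<bullet> column k A) *\<^sub>R column k A) = (\<Sum>k\<in>F. q $ k *\<^sub>R column k A)"
    using exponential_moment_solution[of F "\<lambda>k. q $ k" "\<lambda>k. column k A"] pos by blast
  define p :: "real ^ 'n coord" where "p = (\<chi> k. if k \<in> F then exp (z \<bullet> column k A) else 0)"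
  have "A *v p = (\<Sum>k\<in>F. exp (z \<bullet> column k A) *\<^sub>R column k A)"
    unfolding matrix_mult_sum scalar_mult_eq_scaleR
    by (rule sum.mono_neutral_cong_right) (auto simp: p_def)
  also have "\<dots> = A *v q"
    unfolding matrix_mult_sum scalar_mult_eq_scaleR z
    by (rule sum.mono_neutral_left) (use q(2) in \<open>auto simp: supp_def\<close>)
  finally have eq: "A *v p = A *v q" .
  have "p \<in> prob_vectors"
    using dyad_sum_eq[OF dyad eq] q(1) by (auto simp: prob_vectors_iff p_def)
  with F have "p \<in> closed_model A"
    unfolding facial_set_def by (auto intro: limit_in_closed_model[OF dyad _ _ p_def])
  moreover have "supp p = F"
    by (auto simp: supp_def p_def)
  ultimately show ?thesis
    using eq by (auto simp: moment_map_def)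
qed

section \<open>Faces of the marginal polytope and relative interiors\<close>

lemma face_of_marginal_polytope:
  fixes A :: "real ^ 'n::{card2, linorder} coord ^ 'r::finite"
  assumes dyad: "\<And>m. \<exists>e. \<forall>k. e \<bullet> column k A = m (fst k)"
    and G: "G face_of marginal_polytope A" "G \<noteq> {}"
  obtains F where "facial_set A F" "\<And>d. \<exists>ab. (d, ab) \<in> F"
    "G = (\<lambda>p. A *v p) ` {p \<in> prob_vectors. supp p \<subseteq> F}"
proof -
  have "polytope (marginal_polytope A)"
    unfolding marginal_polytope_def
    by (intro polytope_linear_image polytope_prob_vectors matrix_vector_mul_linear)
  then obtain c b where c: "marginal_polytope A \<subseteq> {x. c \<bullet> x \<le> b}"
    and Gc: "G = marginal_polytope A \<inter> {x. c \<bullet> x = b}"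
    using G(1) exposed_face_of_polyhedron polytope_imp_polyhedron unfolding exposed_face_of_def by metis
  \<comment> \<open>Subtracting the maximum over each dyad makes \<open>c'\<close> nonpositive on
    all columns, with a zero in every dyad.\<close>
  define m where "m d = Max (range (\<lambda>ab. c \<bullet> column (d, ab) A))" for d
  obtain e where e: "\<And>k. e \<bullet> column k A = m (fst k)"
    using dyad by blast
  define c' where "c' = c - e"
  have le: "c' \<bullet> column k A \<le> 0" for k
    by (cases k) (auto simp: c'_def inner_diff_left e m_def intro!: Max_ge)
  define F where "F = {k. c' \<bullet> column k A = 0}"
  have facial: "facial_set A F"
    unfolding facial_set_def by (rule exI[of _ c']) (use le in \<open>auto simp: F_def less_le\<close>)
  have ex: "\<exists>ab. (d, ab) \<in> F" for d
  proof -
    have "m d \<in> range (\<lambda>ab. c \<bullet> column (d, ab) A)"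
      unfolding m_def by (rule Max_in) auto
    then show ?thesis
      by (auto simp: F_def c'_def inner_diff_left e)
  qed
  \<comment> \<open>The functional \<open>e\<close> has the constant value \<open>B\<close> on the
    polytope, so \<open>c\<close> and \<open>c'\<close> have the same maximisers there.\<close>
  define B where "B = (\<Sum>d\<in>UNIV. m d)"
  have e_mult: "e \<bullet> (A *v p) = B" if "p \<in> prob_vectors" for p
    unfolding inner_matrix_vector
    by (subst sum_coord) (use that in \<open>simp add: e B_def prob_vectors_iff flip: sum_distrib_left\<close>)
  have c_mult: "c \<bullet> (A *v p) = B + c' \<bullet> (A *v p)" if "p \<in> prob_vectors" for p
    using e_mult[OF that] by (simp add: c'_def inner_diff_left)
  have nonpos: "(c' \<bullet> column k A) * p $ k \<le> 0" if "p \<in> prob_vectors" for p k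
    using that le by (simp add: prob_vectors_iff mult_nonpos_nonneg)
  have c'_le: "c' \<bullet> (A *v p) \<le> 0" if "p \<in> prob_vectors" for p
    unfolding inner_matrix_vector using nonpos[OF that] by (intro sum_nonpos)
  have c'_eq: "c' \<bullet> (A *v p) = 0 \<longleftrightarrow> supp p \<subseteq> F" if p: "p \<in> prob_vectors" for p
  proof -
    have "c' \<bullet> (A *v p) = 0 \<longleftrightarrow> (\<Sum>k\<in>UNIV. - ((c' \<bullet> column k A) * p $ k)) = 0"
      by (simp add: inner_matrix_vector sum_negf)
    also have "\<dots> \<longleftrightarrow> (\<forall>k. (c' \<bullet> column k A) * p $ k = 0)"
      using nonpos[OF p] by (subst sum_nonneg_eq_0_iff) auto
    finally show ?thesis
      by (auto simp: F_def supp_def)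
  qed
  \<comment> \<open>Both are the maximum of \<open>c\<close> on the polytope: \<open>B\<close> is
    attained at a vector with support \<open>F\<close>, and \<open>b\<close> on the nonempty face
    \<open>G\<close>.\<close>
  have "B = b"
  proof (rule antisym)
    obtain p where "p \<in> prob_vectors" "supp p = F"
      using prob_vector_with_supp[OF ex] by blast
    then show "B \<le> b"
      using c_mult[of p] c'_eq[of p] c by (force simp: marginal_polytope_def)
    obtain p where "p \<in> prob_vectors" "c \<bullet> (A *v p) = b"
      using G(2) Gc by (auto simp: marginal_polytope_def)
    then show "b \<le> B"
      using c_mult[of p] c'_le[of p] by simp
  qed
  then have G_eq: "G = (\<lambda>p. A *v p) ` {p \<in> prob_vectors. supp p \<subseteq> F}"
    unfolding Gc marginal_polytope_def by (auto simp: c_mult simp flip: c'_eq)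
  show ?thesis
    by (rule that[OF facial ex G_eq])
qed

text \<open>Relative interior commutes with linear images of convex sets. Applied to the set
  \<open>F\<close> of a face, and to \<open>UNIV\<close> for the whole polytope.\<close>

lemma rel_interior_image_supported:
  fixes A :: "real ^ 'n::{card2, linorder} coord ^ 'r::finite"
  assumes "\<And>d. \<exists>ab. (d, ab) \<in> F"
  shows "rel_interior ((\<lambda>p. A *v p) ` {p \<in> prob_vectors. supp p \<subseteq> F}) =
    (\<lambda>p. A *v p) ` {p \<in> prob_vectors. supp p = F}"
  using rel_interior_convex_linear_image[OF matrix_vector_mul_linear
      rel_interior_prob_vectors_supported(2), of F A]
    rel_interior_prob_vectors_supported(1)[of F] assms by simp

lemma rel_interior_marginal_cone:
  "rel_interior (marginal_cone A) = {A *v x |x. \<forall>k. 0 < x $ k}"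
proof -
  have "marginal_cone A = (\<lambda>x. A *v x) ` {x. \<forall>k\<in>UNIV. 0 \<le> x $ k}"
    by (auto simp: marginal_cone_def)
  then show ?thesis
    using rel_interior_convex_linear_image[OF matrix_vector_mul_linear convex_nonneg_on, of A UNIV]
    by (simp add: rel_interior_nonneg_on[of UNIV, simplified]) blast
qed

lemma rel_interior_marginal_polytope:
  fixes A :: "real ^ 'n::{card2, linorder} coord ^ 'r::finite"
  shows "rel_interior (marginal_polytope A) = (\<lambda>p. A *v p) ` {p \<in> prob_vectors. \<forall>k. 0 < p $ k}"
proof -
  have "{p :: real ^ 'n coord. p \<in> prob_vectors \<and> supp p = UNIV} = {p \<in> prob_vectors. \<forall>k. 0 < p $ k}"
    by (auto simp: prob_vectors_iff supp_def less_le)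
  then show ?thesis
    using rel_interior_image_supported[of UNIV A] by (simp add: marginal_polytope_def)
qed

theorem theorem3p4:
  fixes v :: p1_version
    and param_of :: "'r::finite \<Rightarrow> 'n::{card2, linorder} p1_param"
    and A :: "real ^ 'n coord ^ 'r"
  assumes "bij_betw param_of UNIV (p1_params v)"
    and "A = design_matrix v param_of"
  shows "(\<forall>t \<in> marginal_polytope A.
            t \<in> rel_interior (marginal_polytope A) \<longleftrightarrow> t \<in> rel_interior (marginal_cone A)) \<and>
         (\<forall>G. G face_of marginal_polytope A \<and> G \<noteq> {} \<longrightarrow>
            (\<exists>F. facial_set A F \<and>
               (\<forall>t \<in> rel_interior G.
                  F = supp (the_inv_into (closed_model A) (moment_map A) t))))"
proof (intro conjI ballI allI impI)
  have dyad: "\<exists>e. \<forall>k. e \<bullet> column k A = m (fst k)" for m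
    using design_matrix_dyad_functional[OF assms(1)] assms(2) by simp
  show "t \<in> rel_interior (marginal_polytope A) \<longleftrightarrow> t \<in> rel_interior (marginal_cone A)"
    if t: "t \<in> marginal_polytope A" for t
  proof
    assume "t \<in> rel_interior (marginal_polytope A)"
    then show "t \<in> rel_interior (marginal_cone A)"
      by (auto simp: rel_interior_marginal_polytope rel_interior_marginal_cone)
  next
    assume "t \<in> rel_interior (marginal_cone A)"
    then obtain x where x: "t = A *v x" "\<And>k. 0 < x $ k"
      by (auto simp: rel_interior_marginal_cone)
    moreover obtain p where "t = A *v p" "p \<in> prob_vectors"
      using t by (auto simp: marginal_polytope_def)
    \<comment> \<open>Positivity of \<open>x\<close> comes from the cone; its dyad sums are those of
      \<open>p\<close>, which has the same image.\<close>
    ultimately have "x \<in> prob_vectors"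
      using dyad_sum_eq[OF dyad, of x p] by (simp add: prob_vectors_iff less_imp_le)
    with x show "t \<in> rel_interior (marginal_polytope A)"
      by (auto simp: rel_interior_marginal_polytope)
  qed
  fix G assume "G face_of marginal_polytope A \<and> G \<noteq> {}"
  then obtain F where F: "facial_set A F" "\<And>d. \<exists>ab. (d, ab) \<in> F"
    "G = (\<lambda>p. A *v p) ` {p \<in> prob_vectors. supp p \<subseteq> F}"
    using face_of_marginal_polytope[OF dyad] by blast
  have "F = supp (the_inv_into (closed_model A) (moment_map A) t)" if t: "t \<in> rel_interior G" for t
  proof -
    \<comment> \<open>The preimage \<open>q\<close> need not lie in the closed model. It is replaced
      by a point \<open>p\<close> there with the same image and support, which injectivity
      identifies with the inverse image of \<open>t\<close>.\<close>
    obtain q where "t = A *v q" "q \<in> prob_vectors" "supp q = F"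
      using t rel_interior_image_supported[OF F(2), of A] F(3) by auto
    then obtain p where "p \<in> closed_model A" "moment_map A p = t" "supp p = F"
      using closed_model_fibre[OF dyad F(1)] by blast
    then show ?thesis
      using the_inv_into_f_eq[OF inj_on_moment_map] by metis
  qed
  with F(1) show "\<exists>F. facial_set A F \<and>
      (\<forall>t \<in> rel_interior G. F = supp (the_inv_into (closed_model A) (moment_map A) t))"
    by blast
qed

end
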